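(* Let $n>s\ge 1$, let $B$ be an $s$-by-$s$ reciprocal matrix, and let $$A=\begin{bmatrix} B & J_{s,n-s}\\ J_{n-s,s} & J_{n-s}\end{bmatrix}.$$ Let $w=(w_1,\ldots,w_n)^T$ be a positive vector such that $(w_1,\ldots,w_s)^T$ is efficient for $B$. Then $w$ is efficient for $A$ if and only if $$\min_{1\le i\le s}w_i\le w_j\le\max_{1\le i\le s}w_i\quad\text{for all } j=s+1,\ldots,n.$$
   Context: An $n$-by-$n$ entrywise positive matrix $A=[a_{ij}]$ is reciprocal if $a_{ji}=1/a_{ij}$ for all $i,j$. $J_{m,k}$ denotes the $m$-by-$k$ all-ones matrix, $J_m=J_{m,m}$. A vector $w$ with positive entries is efficient for a reciprocal matrix $A$ if, for every positive vector $v$, the entrywise inequality $\left|A-[v_i/v_j]\right|\le\left|A-[w_i/w_j]\right|$ implies $v=w$.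
   Formalization: In the definition of efficient, the conclusion "v = w" is replaced by "v is a positive multiple of w"; with literal equality no vector is efficient, since v = 2w gives the same matrix of ratios. *)

theory Defs
  imports Complex_Main "Jordan_Normal_Form.Matrix"
begin

definition reciprocal_mat :: "nat \<Rightarrow> real mat \<Rightarrow> bool" where
  "reciprocal_mat n A \<longleftrightarrow> A \<in> carrier_mat n n \<and>
     (\<forall>i<n. \<forall>j<n. 0 < A $$ (i, j) \<and> A $$ (j, i) = 1 / A $$ (i, j))"

definition ones_mat :: "nat \<Rightarrow> nat \<Rightarrow> real mat" where
  "ones_mat m k = mat m k (\<lambda>_. 1)"

definition positive_vec :: "nat \<Rightarrow> real vec \<Rightarrow> bool" where
  "positive_vec n v \<longleftrightarrow> v \<in> carrier_vec n \<and> (\<forall>i<n. 0 < v $ i)"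

text \<open>
  The matrix with entries v_i / v_j does not change when v is multiplied by a positive
  constant, so positive vectors are identified up to such multiples: the conclusion
  ``v = w'' in the definition of efficiency means that v and w are proportional.
  (With equality of vectors, v = 2 w would show that no vector is efficient.)
\<close>

definition efficient :: "nat \<Rightarrow> real mat \<Rightarrow> real vec \<Rightarrow> bool" where
  "efficient n A w \<longleftrightarrow> positive_vec n w \<and>
     (\<forall>v. positive_vec n v \<longrightarrow>
        (\<forall>i<n. \<forall>j<n. \<bar>A $$ (i, j) - v $ i / v $ j\<bar> \<le> \<bar>A $$ (i, j) - w $ i / w $ j\<bar>) \<longrightarrow>
        (\<exists>c>0. v = c \<cdot>\<^sub>v w))"

end

theory Submission
  imports Defs
begin

text \<open>
  Clipping a vector to an interval \<open>[l, h]\<close> with \<open>l > 0\<close> moves every ratio of entries towards 1.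
  Clip \<open>w\<close> to the range of its first \<open>s\<close> entries: the block \<open>B\<close> sees no change, every entry of the
  other blocks is 1, so the clipped vector approximates \<open>A\<close> at least as well as \<open>w\<close>. If \<open>w\<close> is
  efficient, it therefore equals its clipping.

  Conversely, efficiency for \<open>B\<close> lets us normalise a competitor \<open>v\<close> to agree with \<open>w\<close> on the first
  \<open>s\<close> entries. Comparing a later entry with the smallest of these forces \<open>v\<^sub>j \<le> w\<^sub>j\<close>, and with the
  largest \<open>v\<^sub>j \<ge> w\<^sub>j\<close>.
\<close>

text \<open>With \<open>max\<close> outermost, \<open>l\<close> is a lower bound even without
  \<open>l \<le> h\<close>, so positivity needs only \<open>0 < l\<close>.\<close>

definition clip :: "real \<Rightarrow> real \<Rightarrow> real \<Rightarrow> real" where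
  "clip l h x = max l (min h x)"

lemma clip_eq_iff: "l \<le> h \<Longrightarrow> clip l h x = x \<longleftrightarrow> l \<le> x \<and> x \<le> h"
  by (auto simp: clip_def)

lemma clip_pos: "0 < l \<Longrightarrow> 0 < clip l h x"
  by (simp add: clip_def)

lemma clip_mono: "x \<le> y \<Longrightarrow> clip l h x \<le> clip l h y"
  by (auto simp: clip_def)

text \<open>For positive \<open>x\<close> the quotient \<open>clip l h x / x\<close> is
  \<open>max (l / x) (min (h / x) 1)\<close>, which is non-increasing in \<open>x\<close>;
  cross-multiplying avoids division.\<close>

lemma clip_cross_le:
  assumes "0 < l" "l \<le> h" "0 < x" "x \<le> y"
  shows "clip l h y * x \<le> clip l h x * y"
proof -
  \<comment> \<open>In the first two cases both clipped values coincide; in the other two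
    \<open>clip l h y \<le> y\<close> and \<open>x \<le> clip l h x\<close>.\<close>
  consider "y \<le> l" | "h \<le> x" | "x \<le> l" "l \<le> y" | "l \<le> x" "x \<le> h"
    by linarith
  then show ?thesis
  proof cases
    case 1
    then show ?thesis using assms by (simp add: clip_def)
  next
    case 2
    then show ?thesis using assms by (simp add: clip_def)
  next
    case 3
    have "clip l h y \<le> y" "clip l h x = l"
      using 3 assms by (auto simp: clip_def)
    then have "clip l h y * x \<le> y * l"
      using 3 assms by (intro mult_mono) auto
    then show ?thesis using \<open>clip l h x = l\<close> by (simp add: mult.commute)
  next
    case 4
    have "clip l h y \<le> y" "clip l h x = x"
      using 4 assms by (auto simp: clip_def)
    then show ?thesis using assms by (simp add: mult.commute mult_left_mono)
  qed
qed

text \<open>If \<open>x \<le> y\<close>, monotonicity keeps the clipped ratio at most 1 and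
  \<open>clip_cross_le\<close> keeps it at least \<open>x / y\<close>. The other order is
  symmetric.\<close>

lemma clip_ratio_closer_to_one:
  assumes "0 < l" "l \<le> h" "0 < x" "0 < y"
  shows "\<bar>1 - clip l h x / clip l h y\<bar> \<le> \<bar>1 - x / y\<bar>"
proof (cases "x \<le> y")
  case True
  have "clip l h x / clip l h y \<le> 1"
    using clip_mono[OF True] clip_pos[OF assms(1)] by simp
  moreover have "x / y \<le> clip l h x / clip l h y"
    using clip_cross_le[OF assms(1-3) True] clip_pos[OF assms(1), of h y] assms
    by (simp add: field_simps)
  ultimately show ?thesis by linarith
next
  case False
  then have le: "y \<le> x" by simp
  have "1 \<le> clip l h x / clip l h y"
    using clip_mono[OF le] clip_pos[OF assms(1)] by simp
  moreover have "clip l h x / clip l h y \<le> x / y"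
    using clip_cross_le[OF assms(1,2,4) le] clip_pos[OF assms(1), of h y] assms
    by (simp add: field_simps)
  ultimately show ?thesis by linarith
qed

text \<open>Since \<open>y / a\<close> is at least 1, any \<open>x > y\<close> would push the ratio
  further above 1.\<close>

lemma le_of_ratio_to_smaller_closer:
  fixes a x y :: real
  assumes "0 < a" "a \<le> y" "\<bar>1 - x / a\<bar> \<le> \<bar>1 - y / a\<bar>"
  shows "x \<le> y"
proof -
  have "1 \<le> y / a" using assms by simp
  then have "x / a \<le> y / a" using assms(3) by linarith
  then show ?thesis using assms(1) by (simp add: divide_le_cancel)
qed

text \<open>Mirror image: \<open>y / a\<close> is at most 1, so any \<open>x < y\<close> would push
  the ratio further below 1.\<close>

lemma ge_of_ratio_to_larger_closer:
  fixes a x y :: real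
  assumes "0 < a" "y \<le> a" "\<bar>1 - x / a\<bar> \<le> \<bar>1 - y / a\<bar>"
  shows "y \<le> x"
proof -
  have "y / a \<le> 1" using assms by simp
  then have "y / a \<le> x / a" using assms(3) by linarith
  then show ?thesis using assms(1) by (simp add: divide_le_cancel)
qed

theorem theorem11:
  fixes n s :: nat and A B :: "real mat" and w :: "real vec"
  assumes "1 \<le> s" and "s < n"
    and "reciprocal_mat s B"
    and "A = four_block_mat B (ones_mat s (n - s)) (ones_mat (n - s) s) (ones_mat (n - s) (n - s))"
    and "positive_vec n w"
    and "efficient s B (vec_first w s)"
  shows "efficient n A w \<longleftrightarrow>
    (\<forall>j\<in>{s..<n}. Min ((\<lambda>i. w $ i) ` {..<s}) \<le> w $ j \<and> w $ j \<le> Max ((\<lambda>i. w $ i) ` {..<s}))"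
proof -
  define l where "l = Min ((\<lambda>i. w $ i) ` {..<s})"
  define h where "h = Max ((\<lambda>i. w $ i) ` {..<s})"
  have B: "B \<in> carrier_mat s s" using assms(3) by (simp add: reciprocal_mat_def)
  have A_B: "A $$ (i, j) = B $$ (i, j)" if "i < s" "j < s" for i j
    using B that assms(2,4) by (simp add: ones_mat_def)
  have A_1: "A $$ (i, j) = 1" if "i < n" "j < n" "\<not> (i < s \<and> j < s)" for i j
    using B that assms(2,4) by (auto simp: ones_mat_def)
  have w: "w \<in> carrier_vec n" and w_pos: "\<And>i. i < n \<Longrightarrow> 0 < w $ i"
    using assms(5) by (auto simp: positive_vec_def)
  have ne: "(\<lambda>i. w $ i) ` {..<s} \<noteq> {}" using assms(1) by (auto simp: lessThan_empty_iff)
  obtain p where p: "p < s" "w $ p = l"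
    using Min_in[OF _ ne] unfolding l_def by auto
  obtain q where q: "q < s" "w $ q = h"
    using Max_in[OF _ ne] unfolding h_def by auto
  have range: "l \<le> w $ i" "w $ i \<le> h" if "i < s" for i
    using that by (auto simp: l_def h_def)
  have l_pos: "0 < l" and lh: "l \<le> h"
    using p q w_pos assms(2) range by auto
  have "\<forall>j\<in>{s..<n}. l \<le> w $ j \<and> w $ j \<le> h" if eff: "efficient n A w"
  proof -
    define v where "v = vec n (\<lambda>i. clip l h (w $ i))"
    have "positive_vec n v"
      using clip_pos[OF l_pos] by (auto simp: v_def positive_vec_def)
    moreover have v_fix: "v $ i = w $ i" if "i < s" for i
      using that assms(2) range clip_eq_iff[OF lh] by (simp add: v_def)
    moreover have "\<bar>A $$ (i, j) - v $ i / v $ j\<bar> \<le> \<bar>A $$ (i, j) - w $ i / w $ j\<bar>"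
      if "i < n" "j < n" for i j
    proof (cases "i < s \<and> j < s")
      case True
      then show ?thesis using v_fix by simp
    next
      case False
      then show ?thesis
        using that clip_ratio_closer_to_one[OF l_pos lh] w_pos by (simp add: A_1 v_def)
    qed
    ultimately obtain c where c: "v = c \<cdot>\<^sub>v w"
      using eff unfolding efficient_def by blast
    \<comment> \<open>Index 0 lies in the first block because \<open>1 \<le> s\<close>; clipping
      fixes that entry, which pins the scale to 1.\<close>
    have "v $ 0 = c * w $ 0" using c w assms(2) by simp
    then have "c = 1" using v_fix[of 0] w_pos[of 0] assms(1,2) by simp
    then have "v = w" using c by simp
    then have "clip l h (w $ j) = w $ j" if "j < n" for j
      using that by (metis v_def index_vec)
    then show ?thesis using clip_eq_iff[OF lh] by simp
  qed
  moreover have "efficient n A w" if btw: "\<forall>j\<in>{s..<n}. l \<le> w $ j \<and> w $ j \<le> h"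
    unfolding efficient_def
  proof (intro conjI allI impI)
    fix v
    assume v: "positive_vec n v"
      and le: "\<forall>i<n. \<forall>j<n. \<bar>A $$ (i, j) - v $ i / v $ j\<bar> \<le> \<bar>A $$ (i, j) - w $ i / w $ j\<bar>"
    have v_carrier: "v \<in> carrier_vec n" using v by (simp add: positive_vec_def)
    have first: "vec_first u s $ i = u $ i" if "i < s" for u :: "real vec" and i
      using that by (simp add: vec_first_def)
    have "positive_vec s (vec_first v s)"
      using v assms(2) by (auto simp: positive_vec_def first)
    moreover have "\<forall>i<s. \<forall>j<s. \<bar>B $$ (i, j) - vec_first v s $ i / vec_first v s $ j\<bar>
        \<le> \<bar>B $$ (i, j) - vec_first w s $ i / vec_first w s $ j\<bar>"
    proof (intro allI impI)
      fix i j assume ij: "i < s" "j < s"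
      then show "\<bar>B $$ (i, j) - vec_first v s $ i / vec_first v s $ j\<bar>
        \<le> \<bar>B $$ (i, j) - vec_first w s $ i / vec_first w s $ j\<bar>"
        using le[rule_format, of i j] assms(2) by (simp add: first A_B)
    qed
    ultimately obtain c where c: "c > 0" "vec_first v s = c \<cdot>\<^sub>v vec_first w s"
      using assms(6) unfolding efficient_def by blast
    have v_first: "v $ i = c * w $ i" if "i < s" for i
    proof -
      have "vec_first v s $ i = (c \<cdot>\<^sub>v vec_first w s) $ i" using c(2) by simp
      then show ?thesis using that by (simp add: first vec_first_def)
    qed
    have v_last: "v $ j = c * w $ j" if j: "s \<le> j" "j < n" for j
    proof -
      \<comment> \<open>The entry of \<open>A\<close> at \<open>(j, i)\<close> is 1, and
        \<open>v $ i = c * w $ i\<close> moves the scale \<open>c\<close> into the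
        numerator.\<close>
      have closer: "\<bar>1 - v $ j / c / w $ i\<bar> \<le> \<bar>1 - w $ j / w $ i\<bar>" if "i < s" for i
        using le[rule_format, of j i] that j assms(2) by (simp add: A_1 v_first)
      \<comment> \<open>The indices \<open>p\<close> and \<open>q\<close> attain the minimum and
        maximum, so \<open>btw\<close> gives \<open>w $ p \<le> w $ j \<le> w $ q\<close>, as the
        two comparison lemmas require.\<close>
      have "v $ j / c \<le> w $ j"
        using le_of_ratio_to_smaller_closer[OF _ _ closer[OF p(1)]] p l_pos btw j by auto
      moreover have "w $ j \<le> v $ j / c"
        using ge_of_ratio_to_larger_closer[OF _ _ closer[OF q(1)]] q l_pos lh btw j by auto
      ultimately have "v $ j / c = w $ j" by simp
      then show ?thesis using c(1) by (simp add: field_simps)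
    qed
    have "v = c \<cdot>\<^sub>v w"
    proof (rule eq_vecI)
      fix i assume "i < dim_vec (c \<cdot>\<^sub>v w)"
      then show "v $ i = (c \<cdot>\<^sub>v w) $ i"
        using w v_first v_last by (cases "i < s") auto
    qed (use w v_carrier in auto)
    then show "\<exists>c>0. v = c \<cdot>\<^sub>v w" using c(1) by blast
  qed (rule assms(5))
  ultimately show ?thesis unfolding l_def h_def by blast
qed

end
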